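(* Let $G$ be a first countable Hausdorff topological group which admits a dense countable subgroup, let $(X,d)$ be a compact metric space, and let $\Phi: G\times X\rightarrow X$ be a continuous group action. If $\Phi$ is equicontinuous and pointwise topologically stable, then $\Phi$ is $\beta$-persistent.
   Context: $\operatorname{Act}(G,X)$ denotes the set of all continuous maps $\Phi:G\times X\to X$ such that, writing $\Phi_g=\Phi(g,\cdot)$, each $\Phi_g$ is a homeomorphism of $X$, $\Phi_e=\mathrm{id}_X$ for the identity $e\in G$, and $\Phi_g\circ\Phi_h=\Phi_{gh}$ for all $g,h\in G$. The orbit of $x$ under $\Psi$ is $\mathcal{O}_\Psi(x)=\{\Psi_g(x)\mid g\in G\}$. Fix a dense countable subgroup $H$ of $G$ (the notions below do not depend on its choice). For $\Phi,\Psi\in\operatorname{Act}(G,X)$ put $d_H(\Phi,\Psi)=\sup_{h\in H,\,x\in X} d(\Phi_h(x),\Psi_h(x))$. $\Phi$ is equicontinuous if for each $\epsilon>0$ there is $\delta>0$ such that $x,y\in X$ and $d(x,y)\le\delta$ imply $d(\Phi_h(x),\Phi_h(y))\le\epsilon$ for each $h\in H$. A point $x\in X$ is a topologically stable point of $\Phi$ if for each $\epsilon>0$ there is $\delta>0$ such that for each $\Psi\in\operatorname{Act}(G,X)$ with $d_H(\Phi,\Psi)\le\delta$ there is a continuous map $h:\overline{\mathcal{O}_\Psi(x)}\to X$ with $\Phi_g\circ h=h\circ\Psi_g$ on $\overline{\mathcal{O}_\Psi(x)}$ for each $g\in G$, and $d(h(y),y)\le\epsilon$ for each $y\in\overline{\mathcal{O}_\Psi(x)}$.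 $\Phi$ is pointwise topologically stable if every point of $X$ is a topologically stable point of $\Phi$. $\Phi$ is $\beta$-persistent if for each $\epsilon>0$ there is $\delta>0$ such that for each $\Psi\in\operatorname{Act}(G,X)$ with $d_H(\Phi,\Psi)\le\delta$ and for each $x\in X$ there is $y\in X$ with $d(\Phi_g(x),\Psi_g(y))\le\epsilon$ for each $g\in G$. *)

theory Defs
  imports "HOL-Analysis.Abstract_Metric_Spaces" "HOL-Algebra.Group_Action"
begin

locale topological_group = group G
  for G :: "('g, 'm) monoid_scheme" (structure) and T :: "'g topology" +
  assumes topspace_eq: "topspace T = carrier G"
    and continuous_mult:
      "continuous_map (prod_topology T T) T (\<lambda>(g, h). g \<otimes> h)"
    and continuous_inv: "continuous_map T T (\<lambda>g. inv g)"

text \<open>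
  Actions are total curried HOL functions of which only the values on
  \<^term>\<open>carrier G\<close> and \<^term>\<open>mspace X\<close> matter: every notion below depends on an
  action through these values only, so no extensionality is imposed.
\<close>

definition Act ::
  "('g, 'm) monoid_scheme \<Rightarrow> 'g topology \<Rightarrow> 'x metric \<Rightarrow> ('g \<Rightarrow> 'x \<Rightarrow> 'x) set"
  where "Act G T X = {\<Phi>.
    continuous_map (prod_topology T (mtopology_of X)) (mtopology_of X) (\<lambda>(g, x). \<Phi> g x) \<and>
    (\<forall>g\<in>carrier G. homeomorphic_map (mtopology_of X) (mtopology_of X) (\<Phi> g)) \<and>
    (\<forall>x\<in>mspace X. \<Phi> \<one>\<^bsub>G\<^esub> x = x) \<and>
    (\<forall>g\<in>carrier G. \<forall>h\<in>carrier G. \<forall>x\<in>mspace X. \<Phi> g (\<Phi> h x) = \<Phi> (g \<otimes>\<^bsub>G\<^esub> h) x)}"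

definition countable_dense_subgroup ::
  "('g, 'm) monoid_scheme \<Rightarrow> 'g topology \<Rightarrow> 'g set \<Rightarrow> bool"
  where "countable_dense_subgroup G T H \<longleftrightarrow>
    subgroup H G \<and> countable H \<and> T closure_of H = topspace T"

text \<open>
  The supremum is taken in the reals. For compact nonempty \<^term>\<open>X\<close>, nonempty \<^term>\<open>H\<close> and
  maps into \<^term>\<open>mspace X\<close> the family is nonempty and bounded, so it is a genuine supremum;
  for empty \<^term>\<open>X\<close> its value is unspecified and irrelevant, since the notions
  below that use it then hold vacuously.
\<close>

definition act_dist ::
  "'g set \<Rightarrow> 'x metric \<Rightarrow> ('g \<Rightarrow> 'x \<Rightarrow> 'x) \<Rightarrow> ('g \<Rightarrow> 'x \<Rightarrow> 'x) \<Rightarrow> real"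
  where "act_dist H X \<Phi> \<Psi> = (SUP (h, x)\<in>H \<times> mspace X. mdist X (\<Phi> h x) (\<Psi> h x))"

definition equicontinuous_action ::
  "'g set \<Rightarrow> 'x metric \<Rightarrow> ('g \<Rightarrow> 'x \<Rightarrow> 'x) \<Rightarrow> bool"
  where "equicontinuous_action H X \<Phi> \<longleftrightarrow>
    (\<forall>\<epsilon>>0. \<exists>\<delta>>0. \<forall>x\<in>mspace X. \<forall>y\<in>mspace X. mdist X x y \<le> \<delta> \<longrightarrow>
      (\<forall>h\<in>H. mdist X (\<Phi> h x) (\<Phi> h y) \<le> \<epsilon>))"

abbreviation orbit_closure ::
  "('g, 'm) monoid_scheme \<Rightarrow> 'x metric \<Rightarrow> ('g \<Rightarrow> 'x \<Rightarrow> 'x) \<Rightarrow> 'x \<Rightarrow> 'x set"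
  where "orbit_closure G X \<Psi> x \<equiv> mtopology_of X closure_of orbit G \<Psi> x"

definition topologically_stable_point ::
  "('g, 'm) monoid_scheme \<Rightarrow> 'g topology \<Rightarrow> 'g set \<Rightarrow> 'x metric \<Rightarrow> ('g \<Rightarrow> 'x \<Rightarrow> 'x) \<Rightarrow> 'x \<Rightarrow> bool"
  where "topologically_stable_point G T H X \<Phi> x \<longleftrightarrow>
    (\<forall>\<epsilon>>0. \<exists>\<delta>>0. \<forall>\<Psi>\<in>Act G T X. act_dist H X \<Phi> \<Psi> \<le> \<delta> \<longrightarrow>
      (\<exists>f. continuous_map (subtopology (mtopology_of X) (orbit_closure G X \<Psi> x))
             (mtopology_of X) f \<and>
           (\<forall>g\<in>carrier G. \<forall>y\<in>orbit_closure G X \<Psi> x. \<Phi> g (f y) = f (\<Psi> g y)) \<and>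
           (\<forall>y\<in>orbit_closure G X \<Psi> x. mdist X (f y) y \<le> \<epsilon>)))"

definition pointwise_topologically_stable ::
  "('g, 'm) monoid_scheme \<Rightarrow> 'g topology \<Rightarrow> 'g set \<Rightarrow> 'x metric \<Rightarrow> ('g \<Rightarrow> 'x \<Rightarrow> 'x) \<Rightarrow> bool"
  where "pointwise_topologically_stable G T H X \<Phi> \<longleftrightarrow>
    (\<forall>x\<in>mspace X. topologically_stable_point G T H X \<Phi> x)"

definition beta_persistent ::
  "('g, 'm) monoid_scheme \<Rightarrow> 'g topology \<Rightarrow> 'g set \<Rightarrow> 'x metric \<Rightarrow> ('g \<Rightarrow> 'x \<Rightarrow> 'x) \<Rightarrow> bool"
  where "beta_persistent G T H X \<Phi> \<longleftrightarrow>
    (\<forall>\<epsilon>>0. \<exists>\<delta>>0. \<forall>\<Psi>\<in>Act G T X. act_dist H X \<Phi> \<Psi> \<le> \<delta> \<longrightarrow>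
      (\<forall>x\<in>mspace X. \<exists>y\<in>mspace X. \<forall>g\<in>carrier G. mdist X (\<Phi> g x) (\<Psi> g y) \<le> \<epsilon>))"

end

theory Submission
  imports Defs
begin

text \<open>
  At a topologically stable point \<open>x\<close> the semiconjugacy \<open>f\<close> makes the \<open>\<Phi>\<close>-orbit of \<open>f x\<close>
  shadow the \<open>\<Psi>\<close>-orbit of \<open>x\<close>, and equicontinuity makes the \<open>\<Phi>\<close>-orbits of \<open>x\<close> and \<open>f x\<close>
  stay close; hence the \<open>\<Phi>\<close>- and \<open>\<Psi>\<close>-orbits of \<open>x\<close> stay close, for all \<open>\<Psi>\<close> within
  a distance of \<open>\<Phi>\<close> that depends on \<open>x\<close>. By compactness a finite net of such points suffices:
  a point of the space is shadowed by the \<open>\<Psi>\<close>-orbit of the nearest point of the net.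
\<close>

lemma Act_mspace:
  assumes "\<Phi> \<in> Act G T X" "g \<in> carrier G" "x \<in> mspace X"
  shows "\<Phi> g x \<in> mspace X"
  using assms homeomorphic_imp_continuous_map[of "mtopology_of X" "mtopology_of X" "\<Phi> g"]
  by (auto simp: Act_def continuous_map_def)

lemma continuous_map_Act_orbit:
  assumes "\<Phi> \<in> Act G T X" "x \<in> mspace X"
  shows "continuous_map T (mtopology_of X) (\<lambda>g. \<Phi> g x)"
proof -
  have "continuous_map (prod_topology T (mtopology_of X)) (mtopology_of X) (\<lambda>(g, x). \<Phi> g x)"
    using assms(1) by (simp add: Act_def)
  moreover have "continuous_map T (prod_topology T (mtopology_of X)) (\<lambda>g. (g, x))"
    using assms(2) by (simp add: continuous_map_pairedI)
  ultimately show ?thesis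
    using continuous_map_compose[of T _ "\<lambda>g. (g, x)" _ "\<lambda>(g, x). \<Phi> g x"] by (simp add: o_def)
qed

text \<open>The modulus for \<open>H\<close> serves all of \<open>G\<close>: for fixed
  \<open>x\<close> and \<open>y\<close> the set of \<open>g\<close> satisfying the bound is closed,
  because \<open>g\<close> acts continuously on each point and the bound is not strict. A closed set
  containing the dense \<open>H\<close> is the whole group.\<close>

lemma equicontinuous_actionD:
  assumes "topological_group G T" "countable_dense_subgroup G T H" "\<Phi> \<in> Act G T X"
    and "equicontinuous_action H X \<Phi>" and "\<epsilon> > 0"
  obtains \<delta> where "\<delta> > 0"
    "\<And>x y g. \<lbrakk>x \<in> mspace X; y \<in> mspace X; mdist X x y \<le> \<delta>; g \<in> carrier G\<rbrakk>
      \<Longrightarrow> mdist X (\<Phi> g x) (\<Phi> g y) \<le> \<epsilon>"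
proof -
  obtain \<delta> where \<delta>: "\<delta> > 0"
    "\<And>x y h. \<lbrakk>x \<in> mspace X; y \<in> mspace X; mdist X x y \<le> \<delta>; h \<in> H\<rbrakk>
      \<Longrightarrow> mdist X (\<Phi> h x) (\<Phi> h y) \<le> \<epsilon>"
    using assms(4,5) unfolding equicontinuous_action_def by blast
  have "mdist X (\<Phi> g x) (\<Phi> g y) \<le> \<epsilon>"
    if xy: "x \<in> mspace X" "y \<in> mspace X" "mdist X x y \<le> \<delta>" and g: "g \<in> carrier G" for x y g
  proof -
    have g': "g \<in> T closure_of H"
      using assms(1,2) g by (simp add: countable_dense_subgroup_def topological_group.topspace_eq)
    have "continuous_map T euclideanreal (\<lambda>g. mdist X (\<Phi> g x) (\<Phi> g y))"
      using assms(3) xy by (intro continuous_map_mdist continuous_map_Act_orbit)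
    then have "closedin T {g \<in> topspace T. mdist X (\<Phi> g x) (\<Phi> g y) \<in> {..\<epsilon>}}"
      by (rule closedin_continuous_map_preimage) simp
    then show ?thesis
      by (intro forall_in_closure_of[OF g', of "\<lambda>g. mdist X (\<Phi> g x) (\<Phi> g y) \<le> \<epsilon>"] \<delta>(2) xy) simp_all
  qed
  with \<delta>(1) show ?thesis using that by blast
qed

text \<open>Stability provides a \<Phi>-orbit following a given \<Psi>-orbit, while persistence asks
  for the reverse. Comparing both orbits of the same point \<open>x\<close> removes this asymmetry
  and eliminates the semiconjugacy, so that \<open>x\<close> can later serve as the starting point
  of a shadowing \<Psi>-orbit.\<close>

lemma stable_point_orbits_close:
  assumes "topological_group G T" "countable_dense_subgroup G T H" "\<Phi> \<in> Act G T X"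
    and "equicontinuous_action H X \<Phi>" "topologically_stable_point G T H X \<Phi> x" "x \<in> mspace X"
    and "\<epsilon> > 0"
  shows "\<exists>\<delta>>0. \<forall>\<Psi>\<in>Act G T X. act_dist H X \<Phi> \<Psi> \<le> \<delta> \<longrightarrow>
    (\<forall>g\<in>carrier G. mdist X (\<Phi> g x) (\<Psi> g x) \<le> \<epsilon>)"
proof -
  obtain \<eta> where \<eta>: "\<eta> > 0"
    "\<And>x y g. \<lbrakk>x \<in> mspace X; y \<in> mspace X; mdist X x y \<le> \<eta>; g \<in> carrier G\<rbrakk>
      \<Longrightarrow> mdist X (\<Phi> g x) (\<Phi> g y) \<le> \<epsilon>/2"
    using equicontinuous_actionD[OF assms(1-4), of "\<epsilon>/2"] \<open>\<epsilon> > 0\<close> by auto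
  define \<zeta> where "\<zeta> = min \<eta> (\<epsilon>/2)"
  have "\<zeta> > 0" using \<eta>(1) \<open>\<epsilon> > 0\<close> by (simp add: \<zeta>_def)
  obtain \<delta> where "\<delta> > 0" and \<delta>: "\<forall>\<Psi>\<in>Act G T X. act_dist H X \<Phi> \<Psi> \<le> \<delta> \<longrightarrow>
      (\<exists>f. continuous_map (subtopology (mtopology_of X) (orbit_closure G X \<Psi> x))
             (mtopology_of X) f \<and>
           (\<forall>g\<in>carrier G. \<forall>y\<in>orbit_closure G X \<Psi> x. \<Phi> g (f y) = f (\<Psi> g y)) \<and>
           (\<forall>y\<in>orbit_closure G X \<Psi> x. mdist X (f y) y \<le> \<zeta>))"
    using assms(5)[unfolded topologically_stable_point_def, THEN spec, THEN mp, OF \<open>\<zeta> > 0\<close>]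
    by (elim exE conjE)
  have "mdist X (\<Phi> g x) (\<Psi> g x) \<le> \<epsilon>"
    if \<Psi>: "\<Psi> \<in> Act G T X" "act_dist H X \<Phi> \<Psi> \<le> \<delta>" and g: "g \<in> carrier G" for \<Psi> g
  proof -
    let ?O = "orbit_closure G X \<Psi> x"
    obtain f where f: "continuous_map (subtopology (mtopology_of X) ?O) (mtopology_of X) f"
      "\<And>g y. \<lbrakk>g \<in> carrier G; y \<in> ?O\<rbrakk> \<Longrightarrow> \<Phi> g (f y) = f (\<Psi> g y)"
      "\<And>y. y \<in> ?O \<Longrightarrow> mdist X (f y) y \<le> \<zeta>"
      using \<delta>[THEN bspec, OF \<Psi>(1), THEN mp, OF \<Psi>(2)] by (elim exE conjE) metis
    have orb: "\<Psi> k x \<in> ?O" if "k \<in> carrier G" for k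
      using that Act_mspace[OF \<Psi>(1) _ assms(6)]
      by (intro subsetD[OF closure_of_subset]) (auto simp: orbit_def)
    have "\<one>\<^bsub>G\<^esub> \<in> carrier G"
      using assms(1) by (simp add: topological_group_def group.is_monoid monoid.one_closed)
    with orb[of "\<one>\<^bsub>G\<^esub>"] \<Psi>(1) assms(6) have x: "x \<in> ?O" by (simp add: Act_def)
    have "f x \<in> mspace X"
      using f(1) x assms(6) by (auto simp: continuous_map_def)
    moreover have "mdist X x (f x) \<le> \<eta>"
      using f(3)[OF x] by (simp add: mdist_commute \<zeta>_def)
    ultimately have "mdist X (\<Phi> g x) (\<Phi> g (f x)) \<le> \<epsilon>/2"
      using \<eta>(2) assms(6) g by blast
    \<comment> \<open>By equivariance \<open>\<Phi> g (f x)\<close> is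
      \<open>f (\<Psi> g x)\<close>, and \<open>f\<close> moves the point \<open>\<Psi> g x\<close>
      of the orbit closure by at most \<zeta>.\<close>
    moreover have "mdist X (\<Phi> g (f x)) (\<Psi> g x) \<le> \<epsilon>/2"
      using f(2)[OF g x] f(3)[OF orb[OF g]] by (simp add: \<zeta>_def)
    moreover have "mdist X (\<Phi> g x) (\<Psi> g x)
        \<le> mdist X (\<Phi> g x) (\<Phi> g (f x)) + mdist X (\<Phi> g (f x)) (\<Psi> g x)"
      using Act_mspace assms(3,6) \<Psi>(1) g \<open>f x \<in> mspace X\<close> by (intro mdist_triangle)
    ultimately show ?thesis by linarith
  qed
  with \<open>\<delta> > 0\<close> show ?thesis by blast
qed

lemma compact_space_finite_net:
  assumes "compact_space (mtopology_of X)" "r > 0"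
  obtains K where "finite K" "K \<subseteq> mspace X" "\<And>x. x \<in> mspace X \<Longrightarrow> \<exists>k\<in>K. mdist X x k < r"
proof -
  interpret Metric_space "mspace X" "mdist X"
    by (rule Metric_space_mspace_mdist)
  have "mtotally_bounded (mspace X)"
    using assms(1) by (intro compactin_imp_mtotally_bounded) (simp add: compact_space_def mtopology_of_def)
  then obtain K where K: "finite K" "K \<subseteq> mspace X" "mspace X \<subseteq> (\<Union>x\<in>K. mball x r)"
    using assms(2) unfolding mtotally_bounded_def by meson
  have "\<exists>k\<in>K. mdist X x k < r" if "x \<in> mspace X" for x
    using K(3) that by (force simp: commute)
  with K(1,2) show ?thesis using that by blast
qed

theorem theorem1p1:
  fixes G :: "('g, 'm) monoid_scheme" and T :: "'g topology" and H :: "'g set"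
    and X :: "'x metric" and \<Phi> :: "'g \<Rightarrow> 'x \<Rightarrow> 'x"
  assumes "topological_group G T"
    and "first_countable T"
    and "Hausdorff_space T"
    and "countable_dense_subgroup G T H"
    and "compact_space (mtopology_of X)"
    and "\<Phi> \<in> Act G T X"
    and "equicontinuous_action H X \<Phi>"
    and "pointwise_topologically_stable G T H X \<Phi>"
  shows "beta_persistent G T H X \<Phi>"
  unfolding beta_persistent_def
proof (intro allI impI)
  fix \<epsilon> :: real
  assume "\<epsilon> > 0"
  obtain \<eta> where \<eta>: "\<eta> > 0"
    "\<And>x y g. \<lbrakk>x \<in> mspace X; y \<in> mspace X; mdist X x y \<le> \<eta>; g \<in> carrier G\<rbrakk>
      \<Longrightarrow> mdist X (\<Phi> g x) (\<Phi> g y) \<le> \<epsilon>/2"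
    using equicontinuous_actionD[OF assms(1,4,6,7), of "\<epsilon>/2"] \<open>\<epsilon> > 0\<close> by auto
  \<comment> \<open>The mesh of the net is the equicontinuity modulus for \<epsilon>/2. The net
    depends on \<Phi> and \<epsilon> only, so it is fixed before any \<Psi> is considered.\<close>
  obtain K where K: "finite K" "K \<subseteq> mspace X" "\<And>x. x \<in> mspace X \<Longrightarrow> \<exists>k\<in>K. mdist X x k < \<eta>"
    using compact_space_finite_net[OF assms(5) \<eta>(1)] by blast
  have "\<exists>\<delta>>0. \<forall>\<Psi>\<in>Act G T X. act_dist H X \<Phi> \<Psi> \<le> \<delta> \<longrightarrow>
      (\<forall>g\<in>carrier G. mdist X (\<Phi> g k) (\<Psi> g k) \<le> \<epsilon>/2)" if "k \<in> K" for k
    using stable_point_orbits_close[OF assms(1,4,6,7), of k "\<epsilon>/2"] that K(2) assms(8) \<open>\<epsilon> > 0\<close>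
    by (auto simp: pointwise_topologically_stable_def)
  then obtain \<delta> where \<delta>: "\<And>k. k \<in> K \<Longrightarrow> \<delta> k > 0"
    "\<And>k \<Psi> g. \<lbrakk>k \<in> K; \<Psi> \<in> Act G T X; act_dist H X \<Phi> \<Psi> \<le> \<delta> k; g \<in> carrier G\<rbrakk>
      \<Longrightarrow> mdist X (\<Phi> g k) (\<Psi> g k) \<le> \<epsilon>/2"
    by metis
  \<comment> \<open>The inserted 1 keeps the minimum meaningful when \<open>K\<close> is empty, as
    happens for empty \<open>X\<close>.\<close>
  define d where "d = Min (insert 1 (\<delta> ` K))"
  have "d > 0" using K(1) \<delta>(1) by (simp add: d_def)
  have d_le: "d \<le> \<delta> k" if "k \<in> K" for k
    using K(1) that by (simp add: d_def)
  have "\<exists>y\<in>mspace X. \<forall>g\<in>carrier G. mdist X (\<Phi> g x) (\<Psi> g y) \<le> \<epsilon>"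
    if \<Psi>: "\<Psi> \<in> Act G T X" "act_dist H X \<Phi> \<Psi> \<le> d" and x: "x \<in> mspace X" for \<Psi> x
  proof -
    obtain k where k: "k \<in> K" "mdist X x k < \<eta>"
      using K(3)[OF x] by blast
    then have "k \<in> mspace X" using K(2) by blast
    \<comment> \<open>The net point \<open>k\<close> is the witness for all \<open>g\<close> at
      once. The two halves of \<epsilon> are spent on passing from \<open>x\<close> to
      \<open>k\<close> under \<Phi>, and from \<Phi> to \<Psi> at \<open>k\<close>.\<close>
    have "mdist X (\<Phi> g x) (\<Psi> g k) \<le> \<epsilon>" if g: "g \<in> carrier G" for g
    proof -
      have "mdist X (\<Phi> g x) (\<Phi> g k) \<le> \<epsilon>/2"
        using \<eta>(2) x \<open>k \<in> mspace X\<close> k(2) g by (meson less_imp_le)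
      moreover have "mdist X (\<Phi> g k) (\<Psi> g k) \<le> \<epsilon>/2"
        using \<delta>(2)[OF k(1) \<Psi>(1) _ g] \<Psi>(2) d_le[OF k(1)] by linarith
      moreover have "mdist X (\<Phi> g x) (\<Psi> g k)
          \<le> mdist X (\<Phi> g x) (\<Phi> g k) + mdist X (\<Phi> g k) (\<Psi> g k)"
        using Act_mspace assms(6) \<Psi>(1) g x \<open>k \<in> mspace X\<close> by (intro mdist_triangle)
      ultimately show ?thesis by linarith
    qed
    with \<open>k \<in> mspace X\<close> show ?thesis by blast
  qed
  with \<open>d > 0\<close> show "\<exists>\<delta>>0. \<forall>\<Psi>\<in>Act G T X. act_dist H X \<Phi> \<Psi> \<le> \<delta> \<longrightarrow>
      (\<forall>x\<in>mspace X. \<exists>y\<in>mspace X. \<forall>g\<in>carrier G. mdist X (\<Phi> g x) (\<Psi> g y) \<le> \<epsilon>)"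
    by blast
qed

end
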